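(* Let $X$ be a set, $Y$ a finite set, and $\mathcal{H}$ a non-empty set of functions $X\to 2^Y$ such that for every $h\in\mathcal{H}$ there is $x\in X$ with $h(x)\neq\emptyset$. If $\mathrm{L}_{\mathfrak{P}}(\mathcal{H})=\infty$, then for all $N\in\mathbb{N}$, $\mathcal{M}^*_{\mathcal{H}}(N)=N$.
   Context: Conventions: $0\in\mathbb{N}$; $\Sigma^*$ is the set of finite words over $\Sigma$; for a word $w$, $w_k$ is its $k$-th symbol (starting from $0$) and $w_{:k}$ its prefix of length $k$. For $xy\in(X\times Y)^n$, $x\in X^n$ and $y\in Y^n$ denote its projections. Mistakes. A (deterministic) learner is a map $A:(X\times Y)^*\times X\to 2^Y$. For $h:X\to 2^Y$ and $xy\in(X\times Y)^n$, put $\mathcal{M}^A_h(xy):=\{k<n\mid y_k\notin A(xy_{:k},x_k)\text{ or }A(xy_{:k},x_k)\not\subseteq h(x_k)\}$. Let $\mathcal{C}_h(n)$ be the set of $xy\in(X\times Y)^n$ with $y_k\in h(x_k)$ for all $k<n$. Define $\mathcal{M}^A_h(N):=\max_{xy\in\mathcal{C}_h(N)}|\mathcal{M}^A_h(xy)|$, $\mathcal{M}^A_{\mathcal{H}}(N):=\max_{h\in\mathcal{H}}\mathcal{M}^A_h(N)$, $\mathcal{M}^*_{\mathcal{H}}(N):=\min_A\mathcal{M}^A_{\mathcal{H}}(N)$. Littlestone dimension $\mathrm{L}_{\mathfrak{P}}(\mathcal{H})$: regard $\mathcal{H}$ as a class of partial functions from $X$ to the label set $2^Y\setminus\{\emptyset\}$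 ($h$ is undefined at $x$ iff $h(x)=\emptyset$). A classical shattered $\mathcal{H}$-tree is a perfect binary finite rooted tree (every non-leaf vertex has exactly two children, all leaves have the same depth) with non-leaf vertices $v$ labeled by instances $\mathbf{x}_v\in X$, edges labeled by non-empty sets in $2^Y$, and leaves $u$ labeled by $\mathbf{h}_u\in\mathcal{H}$, such that the two edges going down from a vertex have different labels, and for each leaf $u$ and each edge $a$ on the path from the root to $u$, going down from vertex $v$, the label of $a$ equals $\mathbf{h}_u(\mathbf{x}_v)$. $\mathrm{L}_{\mathfrak{P}}(\mathcal{H})$ is the maximal depth of such a tree, or $\infty$ if unbounded. *)

theory Defs
  imports Main "HOL-Library.Extended_Nat"
begin

type_synonym ('x, 'y) learner = "('x \<times> 'y) list \<times> 'x \<Rightarrow> 'y set"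

definition mistakes :: "('x, 'y) learner \<Rightarrow> ('x \<Rightarrow> 'y set) \<Rightarrow> ('x \<times> 'y) list \<Rightarrow> nat set" where
  "mistakes A h xy = {k. k < length xy \<and>
     (snd (xy ! k) \<notin> A (take k xy, fst (xy ! k)) \<or>
      \<not> A (take k xy, fst (xy ! k)) \<subseteq> h (fst (xy ! k)))}"

definition consistent_seqs :: "('x \<Rightarrow> 'y set) \<Rightarrow> nat \<Rightarrow> ('x \<times> 'y) list set" where
  "consistent_seqs h n = {xy. length xy = n \<and> (\<forall>k<n. snd (xy ! k) \<in> h (fst (xy ! k)))}"

(* Max and Min below range over sets of naturals bounded by N. These sets are non-empty
   if the class is non-empty and every hypothesis has a non-empty value. *)

definition max_mistakes :: "('x, 'y) learner \<Rightarrow> ('x \<Rightarrow> 'y set) \<Rightarrow> nat \<Rightarrow> nat" where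
  "max_mistakes A h N = Max ((\<lambda>xy. card (mistakes A h xy)) ` consistent_seqs h N)"

definition max_mistakes_class ::
  "('x, 'y) learner \<Rightarrow> ('x \<Rightarrow> 'y set) set \<Rightarrow> nat \<Rightarrow> nat" where
  "max_mistakes_class A H N = Max ((\<lambda>h. max_mistakes A h N) ` H)"

definition optimal_mistakes :: "('x \<Rightarrow> 'y set) set \<Rightarrow> nat \<Rightarrow> nat" where
  "optimal_mistakes H N = Min (range (\<lambda>A :: ('x, 'y) learner. max_mistakes_class A H N))"

(* In Node x a l b r, the edges going down to l and r are labeled a and b, respectively. *)

datatype ('x, 'y) htree =
    Leaf "'x \<Rightarrow> 'y set"
  | Node 'x "'y set" "('x, 'y) htree" "'y set" "('x, 'y) htree"

fun depth :: "('x, 'y) htree \<Rightarrow> nat" where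
  "depth (Leaf h) = 0"
| "depth (Node x a l b r) = Suc (max (depth l) (depth r))"

fun perfect :: "('x, 'y) htree \<Rightarrow> bool" where
  "perfect (Leaf h) = True"
| "perfect (Node x a l b r) = (perfect l \<and> perfect r \<and> depth l = depth r)"

fun proper_edges :: "('x, 'y) htree \<Rightarrow> bool" where
  "proper_edges (Leaf h) = True"
| "proper_edges (Node x a l b r) =
     (a \<noteq> {} \<and> b \<noteq> {} \<and> a \<noteq> b \<and> proper_edges l \<and> proper_edges r)"

(* One pair (p, h) per leaf: h is its label, and p lists, from the root down to the leaf,
   the pairs (label of v, label of e) where e is the path's edge going down from v. *)

fun branches :: "('x, 'y) htree \<Rightarrow> (('x \<times> 'y set) list \<times> ('x \<Rightarrow> 'y set)) set" where
  "branches (Leaf h) = {([], h)}"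
| "branches (Node x a l b r) =
     {((x, a) # p, h) | p h. (p, h) \<in> branches l} \<union>
     {((x, b) # p, h) | p h. (p, h) \<in> branches r}"

definition shattered_tree :: "('x \<Rightarrow> 'y set) set \<Rightarrow> ('x, 'y) htree \<Rightarrow> bool" where
  "shattered_tree H t \<longleftrightarrow> perfect t \<and> proper_edges t \<and>
     (\<forall>(p, h) \<in> branches t. h \<in> H \<and> (\<forall>(x, a) \<in> set p. a = h x))"

(* A function h into 'y set stands for the partial function to non-empty label sets that is
   undefined where h x = {}; edge labels being non-empty, h is defined at the instances
   along the branches it labels. *)

definition littlestone_dim :: "('x \<Rightarrow> 'y set) set \<Rightarrow> enat" where
  "littlestone_dim H = (SUP t \<in> {t. shattered_tree H t}. enat (depth t))"

end

theory Submission
  imports Defs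
begin

text \<open>An adversary walks down a shattered tree. At a vertex whose two edges are labeled
  \<open>a \<noteq> b\<close> it can always force a mistake: a prediction not contained in \<open>a\<close> (or in \<open>b\<close>)
  is wrong if the true label set is \<open>a\<close> (or \<open>b\<close>), and a prediction contained in \<open>a \<inter> b\<close>
  misses every point of the symmetric difference of \<open>a\<close> and \<open>b\<close>. A tree of depth at least \<open>N\<close>
  thus yields \<open>N\<close> mistakes in \<open>N\<close> rounds.\<close>

lemma mistakes_subset: "mistakes A h xy \<subseteq> {..<length xy}"
  by (auto simp: mistakes_def)

lemma card_mistakes_le: "card (mistakes A h xy) \<le> length xy"
  using card_mono[OF finite_lessThan mistakes_subset] by fastforce

text \<open>Feeding \<open>A\<close> a history prefixed by \<open>(x, y)\<close> gives another
  learner, whose mistakes on \<open>xy\<close> are those of \<open>A\<close> on the longer sequence,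
  shifted by one round. An induction on the tree can therefore pass to a subtree by changing the
  learner.\<close>

lemma mistakes_Cons_all:
  assumes "y \<notin> A ([], x) \<or> \<not> A ([], x) \<subseteq> h x"
    and "mistakes (\<lambda>(u, z). A ((x, y) # u, z)) h xy = {..<length xy}"
  shows "mistakes A h ((x, y) # xy) = {..<length ((x, y) # xy)}"
proof -
  have "k \<in> mistakes A h ((x, y) # xy)" if "k < Suc (length xy)" for k
  proof (cases k)
    case 0
    then show ?thesis using assms(1) by (simp add: mistakes_def)
  next
    case (Suc j)
    then have "j \<in> mistakes (\<lambda>(u, z). A ((x, y) # u, z)) h xy"
      using that assms(2) by simp
    then show ?thesis by (simp add: mistakes_def Suc)
  qed
  then show ?thesis using mistakes_subset[of A h "(x, y) # xy"] by auto
qed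

lemma consistent_seqs_Cons:
  "(x, y) # xy \<in> consistent_seqs h (Suc n) \<longleftrightarrow> y \<in> h x \<and> xy \<in> consistent_seqs h n"
  by (auto simp: consistent_seqs_def All_less_Suc2)

lemma consistent_seqs_nonempty:
  assumes "h x \<noteq> {}"
  shows "consistent_seqs h n \<noteq> {}"
proof -
  obtain y where "y \<in> h x" using assms by blast
  then have "replicate n (x, y) \<in> consistent_seqs h n"
    by (simp add: consistent_seqs_def)
  then show ?thesis by blast
qed

lemma forced_mistake:
  assumes "a \<noteq> {}" "b \<noteq> {}" "a \<noteq> b"
  obtains y where "y \<in> a" "y \<notin> S \<or> \<not> S \<subseteq> a"
  | y where "y \<in> b" "y \<notin> S \<or> \<not> S \<subseteq> b"
  using assms by blast

lemma branches_nonempty: "branches t \<noteq> {}"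
  by (induction t) auto

text \<open>Whether the labels along a branch agree with its leaf is a premise for the chosen branch
  only, so the induction never mentions the class. At a \<open>Node\<close> this premise gives the
  value of \<open>h\<close> at the root and hands the rest on to the subtree.\<close>

lemma branch_all_mistakes:
  assumes "perfect t" "proper_edges t" "N \<le> depth t"
  shows "\<exists>(p, h) \<in> branches t. (\<forall>(x, a) \<in> set p. a = h x) \<longrightarrow>
    (\<exists>xy \<in> consistent_seqs h N. mistakes A h xy = {..<N})"
  using assms
proof (induction t arbitrary: N A)
  case (Leaf h)
  then show ?case by (simp add: consistent_seqs_def mistakes_def)
next
  case (Node x a l b r)
  show ?case
  proof (cases N)
    \<comment> \<open>The rounds may run out above the leaves; any branch below then serves, with
      the empty sequence.\<close>
    case 0
    have "[] \<in> consistent_seqs h N" "mistakes A h [] = {..<N}" for h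
      by (simp_all add: 0 consistent_seqs_def mistakes_def)
    then show ?thesis
      using branches_nonempty[of "Node x a l b r"] by blast
  next
    case (Suc n)
    \<comment> \<open>\<open>c\<close> is the label of the edge taken. The mistake is forced
      relative to \<open>c\<close>, before any leaf is chosen; \<open>c = h x\<close> turns it into
      a mistake relative to \<open>h\<close>.\<close>
    have step: "\<exists>xy \<in> consistent_seqs h N. mistakes A h xy = {..<N}"
      if y: "y \<in> c" "y \<notin> A ([], x) \<or> \<not> A ([], x) \<subseteq> c" "c = h x"
        and ex: "\<exists>xy \<in> consistent_seqs h n.
          mistakes (\<lambda>(u, z). A ((x, y) # u, z)) h xy = {..<n}" for y c h
    proof -
      obtain xy where xy: "xy \<in> consistent_seqs h n"
        "mistakes (\<lambda>(u, z). A ((x, y) # u, z)) h xy = {..<n}"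
        using ex by blast
      have "length xy = n" using xy(1) by (simp add: consistent_seqs_def)
      then have "mistakes A h ((x, y) # xy) = {..<N}"
        using mistakes_Cons_all[of y A x h xy] y xy(2) Suc by simp
      moreover have "(x, y) # xy \<in> consistent_seqs h N"
        using y xy(1) Suc by (simp add: consistent_seqs_Cons)
      ultimately show ?thesis by blast
    qed
    have edges: "a \<noteq> {}" "b \<noteq> {}" "a \<noteq> b" using Node.prems by auto
    have n: "perfect l" "proper_edges l" "n \<le> depth l"
      "perfect r" "proper_edges r" "n \<le> depth r"
      using Node.prems Suc by auto
    show ?thesis
    \<comment> \<open>The first prediction depends on \<open>x\<close> alone, so it fixes the edge
      and \<open>y\<close>. The induction hypothesis then supplies the leaf, for the learner that
      has already seen \<open>(x, y)\<close>.\<close>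
    proof (cases rule: forced_mistake[OF edges, of "A ([], x)"])
      case (1 y)
      obtain p h where "(p, h) \<in> branches l" "(\<forall>(x, a) \<in> set p. a = h x) \<longrightarrow>
          (\<exists>xy \<in> consistent_seqs h n. mistakes (\<lambda>(u, z). A ((x, y) # u, z)) h xy = {..<n})"
        using Node.IH(1)[of n "\<lambda>(u, z). A ((x, y) # u, z)"] n by blast
      then show ?thesis
        using step[OF 1, of h] by (intro bexI[of _ "((x, a) # p, h)"]) simp_all
    next
      case (2 y)
      obtain p h where "(p, h) \<in> branches r" "(\<forall>(x, a) \<in> set p. a = h x) \<longrightarrow>
          (\<exists>xy \<in> consistent_seqs h n. mistakes (\<lambda>(u, z). A ((x, y) # u, z)) h xy = {..<n})"
        using Node.IH(2)[of n "\<lambda>(u, z). A ((x, y) # u, z)"] n by blast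
      then show ?thesis
        using step[OF 2, of h] by (intro bexI[of _ "((x, b) # p, h)"]) simp_all
    qed
  qed
qed

lemma shattered_tree_all_mistakes:
  assumes "shattered_tree H t" "N \<le> depth t"
  obtains h xy where "h \<in> H" "xy \<in> consistent_seqs h N" "mistakes A h xy = {..<N}"
proof -
  have t: "perfect t" "proper_edges t"
    "\<forall>(p, h) \<in> branches t. h \<in> H \<and> (\<forall>(x, a) \<in> set p. a = h x)"
    using assms(1) unfolding shattered_tree_def by blast+
  obtain p h where ph: "(p, h) \<in> branches t" "(\<forall>(x, a) \<in> set p. a = h x) \<longrightarrow>
      (\<exists>xy \<in> consistent_seqs h N. mistakes A h xy = {..<N})"
    using branch_all_mistakes[OF t(1,2) assms(2), of A] by blast
  have "h \<in> H" "\<forall>(x, a) \<in> set p. a = h x"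
    using bspec[OF t(3) ph(1)] by simp_all
  then show thesis using ph(2) that by blast
qed

text \<open>There may be infinitely many consistent sequences, but their mistake counts lie in
  \<open>{..N}\<close>, so \<open>Max\<close> ranges over a finite set. The value at
  \<open>x\<close> makes it non-empty, without which \<open>Max\<close> would be
  unspecified.\<close>

lemma max_mistakes_bounds:
  assumes "h x \<noteq> {}"
  shows "max_mistakes A h N \<le> N"
    and "xy \<in> consistent_seqs h N \<Longrightarrow> card (mistakes A h xy) \<le> max_mistakes A h N"
proof -
  let ?S = "(\<lambda>xy. card (mistakes A h xy)) ` consistent_seqs h N"
  have sub: "?S \<subseteq> {..N}"
    using card_mistakes_le[of A h] by (fastforce simp: consistent_seqs_def)
  then have "finite ?S" by (rule finite_subset) simp
  then show "max_mistakes A h N \<le> N"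
    and "xy \<in> consistent_seqs h N \<Longrightarrow> card (mistakes A h xy) \<le> max_mistakes A h N"
    using sub consistent_seqs_nonempty[of h x N] assms unfolding max_mistakes_def
    by (auto simp del: Max_le_iff intro!: Max.boundedI)
qed

theorem corollary4p6:
  fixes H :: "('x \<Rightarrow> 'y::finite set) set"
  assumes "H \<noteq> {}"
    and "\<forall>h\<in>H. \<exists>x. h x \<noteq> {}"
    and "littlestone_dim H = \<infinity>"
  shows "\<forall>N::nat. optimal_mistakes H N = N"
proof
  fix N :: nat
  have "enat N < (SUP t \<in> {t. shattered_tree H t}. enat (depth t))"
    using assms(3) by (simp add: littlestone_dim_def)
  then obtain t where t: "shattered_tree H t" "N \<le> depth t"
    unfolding less_SUP_iff by (metis enat_ord_simps(2) less_imp_le mem_Collect_eq)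
  \<comment> \<open>Every learner attains exactly \<open>N\<close>, so the \<open>Min\<close> is
    taken over the singleton of \<open>N\<close>.\<close>
  have "max_mistakes_class A H N = N" for A
  proof -
    obtain h xy where h: "h \<in> H" "xy \<in> consistent_seqs h N" "mistakes A h xy = {..<N}"
      by (rule shattered_tree_all_mistakes[OF t, of A])
    have le: "max_mistakes A g N \<le> N" if g: "g \<in> H" for g
    proof -
      obtain x where "g x \<noteq> {}" using bspec[OF assms(2) g] by blast
      then show ?thesis by (rule max_mistakes_bounds(1))
    qed
    obtain x where "h x \<noteq> {}" using bspec[OF assms(2) h(1)] by blast
    then have "N \<le> max_mistakes A h N"
      using max_mistakes_bounds(2)[of h x xy N A] h(2,3) by simp
    then have "max_mistakes A h N = N" using le[OF h(1)] by simp
    \<comment> \<open>\<open>H\<close> may be infinite; the bound \<open>le\<close> keeps its image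
      within \<open>{..N}\<close>.\<close>
    moreover have "finite ((\<lambda>h. max_mistakes A h N) ` H)"
      using le by (auto intro: finite_subset[of _ "{..N}"])
    ultimately show ?thesis
      unfolding max_mistakes_class_def using le h(1) by (intro Max_eqI) (auto intro: rev_image_eqI)
  qed
  then show "optimal_mistakes H N = N" by (simp add: optimal_mistakes_def)
qed

end
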